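(* Let $\alpha,\beta,\gamma,\delta\in\mathbb{R}$ with $\alpha+\delta\neq0$ and $\alpha\gamma+\beta\delta=0$, and let $(G_5,g,J)$ be the connected three-dimensional non-unimodular Lie group with left-invariant Lorentzian metric $g$ whose Lie algebra has a pseudo-orthonormal basis $\{e_1,e_2,e_3\}$, $e_3$ timelike, with $$[e_1,e_2]=0,\quad [e_1,e_3]=\alpha e_1+\beta e_2,\quad [e_2,e_3]=\gamma e_1+\delta e_2,$$ and with the product structure $J$ given by $Je_1=e_1$, $Je_2=e_2$, $Je_3=-e_3$. Then (with no further condition on the parameters) $(G_5,g,J)$ admits left-invariant Ricci collineations associated to the canonical connection $\nabla^0$.
   Context: Pseudo-orthonormal with $e_3$ timelike means $g(e_1,e_1)=g(e_2,e_2)=1$, $g(e_3,e_3)=-1$, $g(e_i,e_j)=0$ for $i\ne j$. $J$ is extended left-invariantly to a $(1,1)$-tensor with $J^2=\mathrm{id}$. Let $\nabla$ be the Levi-Civita connection of $g$. The canonical connection is $$\nabla^0_XY=\nabla_XY-\tfrac12(\nabla_XJ)JY,$$ with curvature $R^0(X,Y)Z=\nabla^0_X\nabla^0_YZ-\nabla^0_Y\nabla^0_XZ-\nabla^0_{[X,Y]}Z$. Its Ricci tensor is $$\mathrm{Ric}^0(X,Y)=-g(R^0(X,e_1)Y,e_1)-g(R^0(X,e_2)Y,e_2)+g(R^0(X,e_3)Y,e_3),$$ and its symmetrization is $\widetilde{\mathrm{Ric}}^0(X,Y)=\frac12\big(\mathrm{Ric}^0(X,Y)+\mathrm{Ric}^0(Y,X)\big)$.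 For a left-invariant vector field $\xi=\lambda_1e_1+\lambda_2e_2+\lambda_3e_3$ ($\lambda_i\in\mathbb{R}$), $$(L_\xi\widetilde{\mathrm{Ric}}^0)(X,Y)=\xi\big(\widetilde{\mathrm{Ric}}^0(X,Y)\big)-\widetilde{\mathrm{Ric}}^0([\xi,X],Y)-\widetilde{\mathrm{Ric}}^0(X,[\xi,Y]).$$ A left-invariant Ricci collineation associated to $\nabla^0$ is a left-invariant $\xi$ with $L_\xi\widetilde{\mathrm{Ric}}^0=0$. The group admits left-invariant Ricci collineations if there is a nonzero such $\xi$. *)

theory Defs
  imports
    "HOL-Analysis.Analysis"
    "HOL-Algebra.Group"
    "HOL-Library.Function_Algebras"
begin

section \<open>Smooth manifolds and Lie groups\<close>

primrec Ck_on :: "nat \<Rightarrow> 'm::euclidean_space set \<Rightarrow> ('m \<Rightarrow> 'n::real_normed_vector) \<Rightarrow> bool" where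
  "Ck_on 0 S f \<longleftrightarrow> continuous_on S f"
| "Ck_on (Suc k) S f \<longleftrightarrow> (\<forall>x\<in>S. f differentiable (at x)) \<and>
     (\<forall>v. Ck_on k S (\<lambda>x. frechet_derivative f (at x) v))"

definition smooth_on :: "'m::euclidean_space set \<Rightarrow> ('m \<Rightarrow> 'n::real_normed_vector) \<Rightarrow> bool" where
  "smooth_on S f \<longleftrightarrow> (\<forall>k. Ck_on k S f)"

text \<open>A chart is a pair of an open domain U and a coordinate map; only the values of the coordinate
  map on U matter. The manifold is the whole type \<open>'a\<close>; its dimension is that of the model space
  \<open>'m\<close>.\<close>

type_synonym ('a, 'm) atlas = "('a set \<times> ('a \<Rightarrow> 'm)) set"

definition smooth_atlas ::
    "('a::{t2_space,second_countable_topology}, 'm::euclidean_space) atlas \<Rightarrow> bool" where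
  "smooth_atlas A \<longleftrightarrow>
     (\<Union>(U, \<phi>)\<in>A. U) = UNIV \<and>
     (\<forall>(U, \<phi>)\<in>A. open U \<and> open (\<phi> ` U) \<and> homeomorphism U (\<phi> ` U) \<phi> (inv_into U \<phi>)) \<and>
     (\<forall>(U, \<phi>)\<in>A. \<forall>(V, \<psi>)\<in>A. smooth_on (\<phi> ` (U \<inter> V)) (\<psi> \<circ> inv_into U \<phi>))"

definition product_atlas ::
    "('a, 'm) atlas \<Rightarrow> ('b, 'n) atlas \<Rightarrow> ('a \<times> 'b, 'm \<times> 'n) atlas" where
  "product_atlas A B = {(U \<times> V, map_prod \<phi> \<psi>) | U \<phi> V \<psi>. (U, \<phi>) \<in> A \<and> (V, \<psi>) \<in> B}"

definition smooth_map ::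
    "('a::topological_space, 'm::euclidean_space) atlas \<Rightarrow>
     ('b::topological_space, 'n::euclidean_space) atlas \<Rightarrow> ('a \<Rightarrow> 'b) \<Rightarrow> bool" where
  "smooth_map A B F \<longleftrightarrow> continuous_on UNIV F \<and>
     (\<forall>(U, \<phi>)\<in>A. \<forall>(V, \<psi>)\<in>B. smooth_on (\<phi> ` (U \<inter> F -` V)) (\<psi> \<circ> F \<circ> inv_into U \<phi>))"

definition smooth_functions :: "('a, 'm::euclidean_space) atlas \<Rightarrow> ('a \<Rightarrow> real) set" where
  "smooth_functions A = {f. \<forall>(U, \<phi>)\<in>A. smooth_on (\<phi> ` U) (f \<circ> inv_into U \<phi>)}"

definition lie_group ::
    "('a::{t2_space,second_countable_topology}, 'm::euclidean_space) atlas \<Rightarrow> 'a monoid \<Rightarrow> bool" where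
  "lie_group A G \<longleftrightarrow> smooth_atlas A \<and> group G \<and> carrier G = UNIV \<and>
     smooth_map (product_atlas A A) A (\<lambda>(x, y). x \<otimes>\<^bsub>G\<^esub> y) \<and>
     smooth_map A A (\<lambda>x. inv\<^bsub>G\<^esub> x)"

section \<open>Tangent vectors and vector fields\<close>

text \<open>A tangent vector at p is the operator
  $f \mapsto \sum_i a^i\, \partial_i (f \circ \phi^{-1})(\phi(p))$ on smooth functions, for a chart
  $\phi$ around p. As a total HOL function it is 0 on non-smooth functions, so that equality of
  tangent vectors is equality of HOL functions.\<close>

type_synonym 'a tvec = "('a \<Rightarrow> real) \<Rightarrow> real"

definition tangent_space :: "('a, 'm::euclidean_space) atlas \<Rightarrow> 'a \<Rightarrow> 'a tvec set" where
  "tangent_space A p = {v. \<exists>(U, \<phi>)\<in>A. p \<in> U \<and> (\<exists>a.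
     v = (\<lambda>f. if f \<in> smooth_functions A
              then frechet_derivative (f \<circ> inv_into U \<phi>) (at (\<phi> p)) a else 0))}"

type_synonym 'a vfield = "'a \<Rightarrow> 'a tvec"

definition vf_apply :: "'a vfield \<Rightarrow> ('a \<Rightarrow> real) \<Rightarrow> 'a \<Rightarrow> real" where
  "vf_apply X f = (\<lambda>p. X p f)"

definition vector_fields :: "('a, 'm::euclidean_space) atlas \<Rightarrow> 'a vfield set" where
  "vector_fields A = {X. (\<forall>p. X p \<in> tangent_space A p) \<and>
     (\<forall>f\<in>smooth_functions A. vf_apply X f \<in> smooth_functions A)}"

definition vf_scale :: "('a \<Rightarrow> real) \<Rightarrow> 'a vfield \<Rightarrow> 'a vfield" (infixr "\<star>" 75) where
  "h \<star> X = (\<lambda>p f. h p * X p f)"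

definition lie_bracket :: "'a vfield \<Rightarrow> 'a vfield \<Rightarrow> 'a vfield" where
  "lie_bracket X Y = (\<lambda>p f. X p (vf_apply Y f) - Y p (vf_apply X f))"

text \<open>Differential of a smooth map; it does not depend on the base point in this encoding.\<close>

definition pushforward :: "('a \<Rightarrow> 'b) \<Rightarrow> 'a tvec \<Rightarrow> 'b tvec" where
  "pushforward F v = (\<lambda>f. v (f \<circ> F))"

definition left_invariant_fields ::
    "('a, 'm::euclidean_space) atlas \<Rightarrow> 'a monoid \<Rightarrow> 'a vfield set" where
  "left_invariant_fields A G = {X \<in> vector_fields A.
     \<forall>a p. X (a \<otimes>\<^bsub>G\<^esub> p) = pushforward (\<lambda>x. a \<otimes>\<^bsub>G\<^esub> x) (X p)}"

definition lie_algebra_basis ::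
    "('a, 'm::euclidean_space) atlas \<Rightarrow> 'a monoid \<Rightarrow> 'a vfield \<Rightarrow> 'a vfield \<Rightarrow> 'a vfield \<Rightarrow> bool" where
  "lie_algebra_basis A G e1 e2 e3 \<longleftrightarrow>
     (\<forall>c :: real^3. (\<lambda>_. c$1) \<star> e1 + (\<lambda>_. c$2) \<star> e2 + (\<lambda>_. c$3) \<star> e3 \<in> left_invariant_fields A G) \<and>
     (\<forall>X\<in>left_invariant_fields A G. \<exists>!c :: real^3.
        X = (\<lambda>_. c$1) \<star> e1 + (\<lambda>_. c$2) \<star> e2 + (\<lambda>_. c$3) \<star> e3)"

section \<open>Left-invariant tensors\<close>

type_synonym 'a metric = "'a \<Rightarrow> 'a tvec \<Rightarrow> 'a tvec \<Rightarrow> real"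

definition metric_apply :: "'a metric \<Rightarrow> 'a vfield \<Rightarrow> 'a vfield \<Rightarrow> 'a \<Rightarrow> real" where
  "metric_apply g X Y = (\<lambda>p. g p (X p) (Y p))"

definition pseudo_orthonormal ::
    "('v \<Rightarrow> 'v \<Rightarrow> real) \<Rightarrow> 'v \<Rightarrow> 'v \<Rightarrow> 'v \<Rightarrow> bool" where
  "pseudo_orthonormal b u1 u2 u3 \<longleftrightarrow>
     b u1 u1 = 1 \<and> b u2 u2 = 1 \<and> b u3 u3 = - 1 \<and>
     b u1 u2 = 0 \<and> b u2 u1 = 0 \<and> b u1 u3 = 0 \<and> b u3 u1 = 0 \<and> b u2 u3 = 0 \<and> b u3 u2 = 0"

definition lorentzian_metric_3 :: "('a, real^3) atlas \<Rightarrow> 'a metric \<Rightarrow> bool" where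
  "lorentzian_metric_3 A g \<longleftrightarrow>
     (\<forall>p. \<forall>u\<in>tangent_space A p. \<forall>v\<in>tangent_space A p. g p u v = g p v u) \<and>
     (\<forall>p. \<forall>u\<in>tangent_space A p. \<forall>v\<in>tangent_space A p. \<forall>w\<in>tangent_space A p. \<forall>c.
        g p (\<lambda>f. c * u f + v f) w = c * g p u w + g p v w) \<and>
     (\<forall>p. \<forall>u\<in>tangent_space A p. (\<forall>v\<in>tangent_space A p. g p u v = 0) \<longrightarrow> u = (\<lambda>_. 0)) \<and>
     (\<forall>p. \<exists>u1\<in>tangent_space A p. \<exists>u2\<in>tangent_space A p. \<exists>u3\<in>tangent_space A p.
        pseudo_orthonormal (g p) u1 u2 u3) \<and>
     (\<forall>X\<in>vector_fields A. \<forall>Y\<in>vector_fields A. metric_apply g X Y \<in> smooth_functions A)"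

definition left_invariant_metric ::
    "('a, 'm::euclidean_space) atlas \<Rightarrow> 'a monoid \<Rightarrow> 'a metric \<Rightarrow> bool" where
  "left_invariant_metric A G g \<longleftrightarrow>
     (\<forall>a p. \<forall>u\<in>tangent_space A p. \<forall>v\<in>tangent_space A p.
        g (a \<otimes>\<^bsub>G\<^esub> p) (pushforward (\<lambda>x. a \<otimes>\<^bsub>G\<^esub> x) u) (pushforward (\<lambda>x. a \<otimes>\<^bsub>G\<^esub> x) v) = g p u v)"

type_synonym 'a endo = "'a \<Rightarrow> 'a tvec \<Rightarrow> 'a tvec"

definition endo_apply :: "'a endo \<Rightarrow> 'a vfield \<Rightarrow> 'a vfield" where
  "endo_apply J X = (\<lambda>p. J p (X p))"

definition tensor_11 :: "('a, 'm::euclidean_space) atlas \<Rightarrow> 'a endo \<Rightarrow> bool" where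
  "tensor_11 A J \<longleftrightarrow>
     (\<forall>p. \<forall>u\<in>tangent_space A p. J p u \<in> tangent_space A p) \<and>
     (\<forall>p. \<forall>u\<in>tangent_space A p. \<forall>v\<in>tangent_space A p. \<forall>c.
        J p (\<lambda>f. c * u f + v f) = (\<lambda>f. c * J p u f + J p v f)) \<and>
     (\<forall>X\<in>vector_fields A. endo_apply J X \<in> vector_fields A)"

definition left_invariant_endo ::
    "('a, 'm::euclidean_space) atlas \<Rightarrow> 'a monoid \<Rightarrow> 'a endo \<Rightarrow> bool" where
  "left_invariant_endo A G J \<longleftrightarrow>
     (\<forall>a p. \<forall>u\<in>tangent_space A p.
        J (a \<otimes>\<^bsub>G\<^esub> p) (pushforward (\<lambda>x. a \<otimes>\<^bsub>G\<^esub> x) u) = pushforward (\<lambda>x. a \<otimes>\<^bsub>G\<^esub> x) (J p u))"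

section \<open>Connections, curvature and Ricci collineations\<close>

text \<open>\<open>D X Y\<close> stands for $D_X Y$; it is only constrained on vector fields.\<close>

type_synonym 'a connection = "'a vfield \<Rightarrow> 'a vfield \<Rightarrow> 'a vfield"

definition affine_connection :: "('a, 'm::euclidean_space) atlas \<Rightarrow> 'a connection \<Rightarrow> bool" where
  "affine_connection A D \<longleftrightarrow>
     (\<forall>X\<in>vector_fields A. \<forall>Y\<in>vector_fields A. D X Y \<in> vector_fields A) \<and>
     (\<forall>X\<in>vector_fields A. \<forall>X'\<in>vector_fields A. \<forall>Y\<in>vector_fields A.
        D (X + X') Y = D X Y + D X' Y) \<and>
     (\<forall>f\<in>smooth_functions A. \<forall>X\<in>vector_fields A. \<forall>Y\<in>vector_fields A.
        D (f \<star> X) Y = f \<star> D X Y) \<and>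
     (\<forall>X\<in>vector_fields A. \<forall>Y\<in>vector_fields A. \<forall>Y'\<in>vector_fields A.
        D X (Y + Y') = D X Y + D X Y') \<and>
     (\<forall>f\<in>smooth_functions A. \<forall>X\<in>vector_fields A. \<forall>Y\<in>vector_fields A.
        D X (f \<star> Y) = f \<star> D X Y + vf_apply X f \<star> Y)"

definition levi_civita_connection ::
    "('a, 'm::euclidean_space) atlas \<Rightarrow> 'a metric \<Rightarrow> 'a connection \<Rightarrow> bool" where
  "levi_civita_connection A g D \<longleftrightarrow> affine_connection A D \<and>
     (\<forall>X\<in>vector_fields A. \<forall>Y\<in>vector_fields A. D X Y - D Y X = lie_bracket X Y) \<and>
     (\<forall>X\<in>vector_fields A. \<forall>Y\<in>vector_fields A. \<forall>Z\<in>vector_fields A.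
        vf_apply X (metric_apply g Y Z) = metric_apply g (D X Y) Z + metric_apply g Y (D X Z))"

text \<open>$(D_X J) Z = D_X (J Z) - J (D_X Z)$\<close>

definition deriv_endo :: "'a connection \<Rightarrow> 'a endo \<Rightarrow> 'a vfield \<Rightarrow> 'a vfield \<Rightarrow> 'a vfield" where
  "deriv_endo D J X Z = D X (endo_apply J Z) - endo_apply J (D X Z)"

definition canonical_connection :: "'a connection \<Rightarrow> 'a endo \<Rightarrow> 'a connection" where
  "canonical_connection D J X Y = D X Y - (\<lambda>_. 1/2) \<star> deriv_endo D J X (endo_apply J Y)"

definition curvature ::
    "'a connection \<Rightarrow> 'a vfield \<Rightarrow> 'a vfield \<Rightarrow> 'a vfield \<Rightarrow> 'a vfield" where
  "curvature D X Y Z = D X (D Y Z) - D Y (D X Z) - D (lie_bracket X Y) Z"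

definition ricci ::
    "'a metric \<Rightarrow> 'a connection \<Rightarrow> 'a vfield \<Rightarrow> 'a vfield \<Rightarrow> 'a vfield \<Rightarrow>
     'a vfield \<Rightarrow> 'a vfield \<Rightarrow> 'a \<Rightarrow> real" where
  "ricci g D e1 e2 e3 X Y =
     - metric_apply g (curvature D X e1 Y) e1 - metric_apply g (curvature D X e2 Y) e2
     + metric_apply g (curvature D X e3 Y) e3"

definition symmetrized ::
    "('a vfield \<Rightarrow> 'a vfield \<Rightarrow> 'a \<Rightarrow> real) \<Rightarrow> 'a vfield \<Rightarrow> 'a vfield \<Rightarrow> 'a \<Rightarrow> real" where
  "symmetrized T X Y = (\<lambda>p. (T X Y p + T Y X p) / 2)"

definition lie_derivative_02 ::
    "'a vfield \<Rightarrow> ('a vfield \<Rightarrow> 'a vfield \<Rightarrow> 'a \<Rightarrow> real) \<Rightarrow> 'a vfield \<Rightarrow> 'a vfield \<Rightarrow> 'a \<Rightarrow> real" where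
  "lie_derivative_02 \<xi> T X Y =
     vf_apply \<xi> (T X Y) - T (lie_bracket \<xi> X) Y - T X (lie_bracket \<xi> Y)"

text \<open>Here \<open>D\<close> is the connection the collineation is associated to, and \<open>e1\<close>, \<open>e2\<close>, \<open>e3\<close> the
  pseudo-orthonormal frame (\<open>e3\<close> timelike) used for the trace in the Ricci tensor.\<close>

definition left_invariant_ricci_collineation ::
    "('a, real^3) atlas \<Rightarrow> 'a monoid \<Rightarrow> 'a metric \<Rightarrow> 'a connection \<Rightarrow>
     'a vfield \<Rightarrow> 'a vfield \<Rightarrow> 'a vfield \<Rightarrow> 'a vfield \<Rightarrow> bool" where
  "left_invariant_ricci_collineation A G g D e1 e2 e3 \<xi> \<longleftrightarrow>
     \<xi> \<in> left_invariant_fields A G \<and>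
     (\<forall>X\<in>vector_fields A. \<forall>Y\<in>vector_fields A.
        lie_derivative_02 \<xi> (symmetrized (ricci g D e1 e2 e3)) X Y = 0)"

definition admits_left_invariant_ricci_collineations ::
    "('a, real^3) atlas \<Rightarrow> 'a monoid \<Rightarrow> 'a metric \<Rightarrow> 'a connection \<Rightarrow>
     'a vfield \<Rightarrow> 'a vfield \<Rightarrow> 'a vfield \<Rightarrow> bool" where
  "admits_left_invariant_ricci_collineations A G g D e1 e2 e3 \<longleftrightarrow>
     (\<exists>\<xi>. \<xi> \<noteq> 0 \<and> left_invariant_ricci_collineation A G g D e1 e2 e3 \<xi>)"

end

(* In terms of the eigenbundles of J, the canonical connection is the sum of the connections which
   the Levi-Civita connection induces on span(e1, e2) and on span(e3). The second is trivial, and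
   the first is D0_X e1 = omega(X) e2, D0_X e2 = - omega(X) e1. Koszul's formula makes omega a constant
   multiple of the form theta dual to e3, and theta is closed because all brackets lie in
   span(e1, e2). Hence D0 is flat, the Ricci tensor vanishes, and every left-invariant field is a
   Ricci collineation. *)
theory Submission
  imports Defs
begin

section \<open>Smooth functions\<close>

text \<open>On an open set the values near a point determine the derivative there, so agreement on
  \<open>S\<close> passes to all directional derivatives. This lets the inductions below replace the
  derivative of a sum or product by its explicit formula.\<close>

lemma Ck_on_cong:
  assumes "open S" "\<And>x. x \<in> S \<Longrightarrow> f x = g x" "Ck_on k S f"
  shows "Ck_on k S g"
  using assms(2,3)
proof (induction k arbitrary: f g)
  case 0
  then show ?case using continuous_on_cong[of S S f g] by auto
next
  case (Suc k)
  have d: "(g has_derivative frechet_derivative f (at x)) (at x)" if "x \<in> S" for x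
    using Suc.prems(2) that assms(1) Suc.prems(1)
    by (intro has_derivative_transform_within_open[of f _ x UNIV S g])
      (auto simp: frechet_derivative_works)
  have e: "frechet_derivative f (at x) = frechet_derivative g (at x)" if "x \<in> S" for x
    using frechet_derivative_at[OF d[OF that]] .
  have "Ck_on k S (\<lambda>x. frechet_derivative g (at x) v)" for v
    by (rule Suc.IH[of "\<lambda>x. frechet_derivative f (at x) v"]) (use e Suc.prems in auto)
  then show ?case using d by (auto simp: differentiable_def)
qed

lemma Ck_on_Suc_imp: "Ck_on (Suc k) S f \<Longrightarrow> Ck_on k S f"
proof (induction k arbitrary: f)
  case 0
  then show ?case
    by (auto intro!: differentiable_imp_continuous_on differentiable_at_imp_differentiable_on)
next
  case (Suc k)
  then show ?case by (metis Ck_on.simps(2))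
qed

lemma Ck_on_const: "Ck_on k S (\<lambda>_. c)"
  by (induction k arbitrary: c) auto

lemma frechet_derivative_add:
  assumes "f differentiable (at x)" "g differentiable (at x)"
  shows "frechet_derivative (\<lambda>x. f x + g x) (at x) v
    = frechet_derivative f (at x) v + frechet_derivative g (at x) v"
  using frechet_derivative_at[OF has_derivative_add[OF assms[unfolded frechet_derivative_works]]]
  by (simp add: fun_eq_iff)

lemma frechet_derivative_mult:
  fixes f g :: "'m::real_normed_vector \<Rightarrow> real"
  assumes "f differentiable (at x)" "g differentiable (at x)"
  shows "frechet_derivative (\<lambda>x. f x * g x) (at x) v
    = f x * frechet_derivative g (at x) v + frechet_derivative f (at x) v * g x"
  using frechet_derivative_at[OF has_derivative_mult[OF assms[unfolded frechet_derivative_works]]]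
  by (simp add: fun_eq_iff)

lemma Ck_on_add:
  assumes "open S" "Ck_on k S f" "Ck_on k S g"
  shows "Ck_on k S (\<lambda>x. f x + g x)"
  using assms(2,3)
proof (induction k arbitrary: f g)
  case 0
  then show ?case by (auto intro: continuous_on_add)
next
  case (Suc k)
  have "Ck_on k S (\<lambda>x. frechet_derivative (\<lambda>x. f x + g x) (at x) v)" for v
  proof (rule Ck_on_cong[OF assms(1)])
    show "Ck_on k S (\<lambda>x. frechet_derivative f (at x) v + frechet_derivative g (at x) v)"
      using Suc by auto
    show "frechet_derivative f (at x) v + frechet_derivative g (at x) v
        = frechet_derivative (\<lambda>x. f x + g x) (at x) v" if "x \<in> S" for x
      using Suc.prems that by (subst frechet_derivative_add) auto
  qed
  then show ?case using Suc.prems by (auto intro: differentiable_add)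
qed

lemma Ck_on_mult:
  fixes f g :: "'m::euclidean_space \<Rightarrow> real"
  assumes "open S" "Ck_on k S f" "Ck_on k S g"
  shows "Ck_on k S (\<lambda>x. f x * g x)"
  using assms(2,3)
proof (induction k arbitrary: f g)
  case 0
  then show ?case by (auto intro: continuous_on_mult)
next
  case (Suc k)
  have "Ck_on k S (\<lambda>x. frechet_derivative (\<lambda>x. f x * g x) (at x) v)" for v
  proof (rule Ck_on_cong[OF assms(1)])
    \<comment> \<open>The product rule mixes derivatives, which are of class \<open>k\<close>, with
      the factors themselves, which are of class \<open>Suc k\<close> and have to be lowered to
      \<open>k\<close> first.\<close>
    show "Ck_on k S (\<lambda>x. f x * frechet_derivative g (at x) v + frechet_derivative f (at x) v * g x)"
      using Suc.prems Suc.IH Ck_on_Suc_imp[OF Suc.prems(1)] Ck_on_Suc_imp[OF Suc.prems(2)]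
      by (intro Ck_on_add assms(1) Suc.IH) auto
    show "f x * frechet_derivative g (at x) v + frechet_derivative f (at x) v * g x
        = frechet_derivative (\<lambda>x. f x * g x) (at x) v" if "x \<in> S" for x
      using Suc.prems that by (subst frechet_derivative_mult) auto
  qed
  then show ?case using Suc.prems by (auto intro: differentiable_mult)
qed

lemma smooth_on_differentiable: "smooth_on S f \<Longrightarrow> x \<in> S \<Longrightarrow> f differentiable (at x)"
  unfolding smooth_on_def using Ck_on.simps(2)[of 0 S f] by blast

section \<open>Tangent spaces and vector fields\<close>

locale smooth_mfd =
  fixes A :: "('a::{t2_space,second_countable_topology}, 'm::euclidean_space) atlas"
  assumes atlas: "smooth_atlas A"
begin

abbreviation "S \<equiv> smooth_functions A"
abbreviation "V \<equiv> vector_fields A"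
abbreviation "T p \<equiv> tangent_space A p"

text \<open>The tangent vector with coordinates \<open>a\<close> in the chart, written exactly as in
  \<open>tangent_space\<close> so that unfolding identifies the two.\<close>

definition chart_vec :: "'a set \<Rightarrow> ('a \<Rightarrow> 'm) \<Rightarrow> 'a \<Rightarrow> 'm \<Rightarrow> 'a tvec" where
  "chart_vec U \<phi> p a =
     (\<lambda>f. if f \<in> S then frechet_derivative (f \<circ> inv_into U \<phi>) (at (\<phi> p)) a else 0)"

lemma chart_open: "(U, \<phi>) \<in> A \<Longrightarrow> open U" "(U, \<phi>) \<in> A \<Longrightarrow> open (\<phi> ` U)"
  and chart_homeo: "(U, \<phi>) \<in> A \<Longrightarrow> homeomorphism U (\<phi> ` U) \<phi> (inv_into U \<phi>)"
  using atlas unfolding smooth_atlas_def Ball_def split_paired_All prod.case by meson+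

lemma ex_chart: "\<exists>U \<phi>. (U, \<phi>) \<in> A \<and> p \<in> U"
proof -
  have "p \<in> (\<Union>(U, \<phi>)\<in>A. U)" using atlas by (simp only: smooth_atlas_def UNIV_I)
  then show ?thesis by blast
qed

lemma smooth_chart:
  assumes "f \<in> S" "(U, \<phi>) \<in> A"
  shows "smooth_on (\<phi> ` U) (f \<circ> inv_into U \<phi>)"
  using bspec[OF assms(1)[unfolded smooth_functions_def mem_Collect_eq] assms(2)] by simp

lemma smoothI:
  assumes "\<And>U \<phi> k. (U, \<phi>) \<in> A \<Longrightarrow> Ck_on k (\<phi> ` U) (f \<circ> inv_into U \<phi>)"
  shows "f \<in> S"
  using assms unfolding smooth_functions_def smooth_on_def by blast

lemma chart_differentiable:
  assumes "f \<in> S" "(U, \<phi>) \<in> A" "p \<in> U"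
  shows "(f \<circ> inv_into U \<phi>) differentiable (at (\<phi> p))"
  using smooth_on_differentiable[OF smooth_chart] assms by blast

lemma smooth_const: "(\<lambda>_. c) \<in> S"
  by (rule smoothI) (simp only: comp_def Ck_on_const)

lemma smooth_add:
  assumes "f \<in> S" "h \<in> S"
  shows "(\<lambda>x. f x + h x) \<in> S"
proof (rule smoothI)
  fix U \<phi> k assume U: "(U, \<phi>) \<in> A"
  show "Ck_on k (\<phi> ` U) ((\<lambda>x. f x + h x) \<circ> inv_into U \<phi>)"
    using Ck_on_add[OF chart_open(2)[OF U], of k "f \<circ> inv_into U \<phi>" "h \<circ> inv_into U \<phi>"]
      smooth_chart[OF assms(1) U] smooth_chart[OF assms(2) U]
    by (simp add: comp_def smooth_on_def)
qed

lemma smooth_mult: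
  assumes "f \<in> S" "h \<in> S"
  shows "(\<lambda>x. f x * h x) \<in> S"
proof (rule smoothI)
  fix U \<phi> k assume U: "(U, \<phi>) \<in> A"
  show "Ck_on k (\<phi> ` U) ((\<lambda>x. f x * h x) \<circ> inv_into U \<phi>)"
    using Ck_on_mult[OF chart_open(2)[OF U], of k "f \<circ> inv_into U \<phi>" "h \<circ> inv_into U \<phi>"]
      smooth_chart[OF assms(1) U] smooth_chart[OF assms(2) U]
    by (simp add: comp_def smooth_on_def)
qed

lemma chart_vec_linear:
  assumes "(U, \<phi>) \<in> A" "p \<in> U"
  shows "chart_vec U \<phi> p (c *\<^sub>R a + b) = (\<lambda>f. c * chart_vec U \<phi> p a f + chart_vec U \<phi> p b f)"
proof
  fix f
  show "chart_vec U \<phi> p (c *\<^sub>R a + b) f = c * chart_vec U \<phi> p a f + chart_vec U \<phi> p b f"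
  proof (cases "f \<in> S")
    case True
    interpret linear "frechet_derivative (f \<circ> inv_into U \<phi>) (at (\<phi> p))"
      by (rule linear_frechet_derivative[OF chart_differentiable[OF True assms]])
    show ?thesis using True by (simp add: chart_vec_def add scale)
  qed (simp add: chart_vec_def)
qed

text \<open>Chain rule: the coordinates in the second chart are the derivative of the transition map
  applied to \<open>a\<close>.\<close>

lemma chart_vec_change:
  assumes U: "(U, \<phi>) \<in> A" "p \<in> U" and W: "(W, \<psi>) \<in> A" "p \<in> W"
  shows "chart_vec U \<phi> p a \<in> range (chart_vec W \<psi> p)"
proof -
  let ?t = "\<psi> \<circ> inv_into U \<phi>"
  let ?O = "\<phi> ` (U \<inter> W)"
  have O: "open ?O"
  proof -
    have "openin (top_of_set (\<phi> ` U)) ?O"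
      by (rule homeomorphism_imp_open_map[OF chart_homeo[OF U(1)]])
        (use chart_open(1)[OF W(1)] in \<open>auto simp: openin_open\<close>)
    then show ?thesis using chart_open(2)[OF U(1)] openin_open_trans by blast
  qed
  have inv: "inv_into U \<phi> (\<phi> x) = x" if "x \<in> U" for x
    using chart_homeo[OF U(1)] that by (auto simp: homeomorphism_def)
  have invW: "inv_into W \<psi> (\<psi> x) = x" if "x \<in> W" for x
    using chart_homeo[OF W(1)] that by (auto simp: homeomorphism_def)
  have "smooth_on ?O ?t"
    using atlas U(1) W(1) unfolding smooth_atlas_def by fast
  then have "?t differentiable (at (\<phi> p))"
    using U W by (intro smooth_on_differentiable) auto
  then have t: "(?t has_derivative frechet_derivative ?t (at (\<phi> p))) (at (\<phi> p))"
    by (simp add: frechet_derivative_works)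
  have "chart_vec U \<phi> p a f = chart_vec W \<psi> p (frechet_derivative ?t (at (\<phi> p)) a) f" for f
  proof (cases "f \<in> S")
    case True
    let ?d = "frechet_derivative (f \<circ> inv_into W \<psi>) (at (\<psi> p))"
    have d: "((f \<circ> inv_into W \<psi>) has_derivative ?d) (at (?t (\<phi> p)))"
      using chart_differentiable[OF True W] U inv by (simp add: frechet_derivative_works)
    have "((f \<circ> inv_into W \<psi>) \<circ> ?t has_derivative ?d \<circ> frechet_derivative ?t (at (\<phi> p))) (at (\<phi> p))"
      using diff_chain_at[OF t d] .
    then have "((f \<circ> inv_into U \<phi>) has_derivative ?d \<circ> frechet_derivative ?t (at (\<phi> p))) (at (\<phi> p))"
      \<comment> \<open>On the overlap \<open>inv_into W \<psi>\<close> cancels \<psi>, so both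
        functions agree on the open set \<open>?O\<close> around \<open>\<phi> p\<close>.\<close>
      by (rule has_derivative_transform_within_open[OF _ O]) (use U W inv invW in auto)
    from frechet_derivative_at[OF this] show ?thesis
      using True by (simp add: chart_vec_def fun_eq_iff)
  qed (simp add: chart_vec_def)
  then show ?thesis by blast
qed

text \<open>\<open>tangent_space\<close> lets the chart vary with the vector. With one chart fixed,
  vectors at p can be combined through their coordinates.\<close>

lemma tangent_space_chart:
  assumes "(U, \<phi>) \<in> A" "p \<in> U"
  shows "T p = range (chart_vec U \<phi> p)"
proof
  show "range (chart_vec U \<phi> p) \<subseteq> T p"
    using assms unfolding tangent_space_def chart_vec_def by blast
  show "T p \<subseteq> range (chart_vec U \<phi> p)"
  proof
    fix v assume "v \<in> T p"
    then obtain W \<psi> a where "(W, \<psi>) \<in> A" "p \<in> W" "v = chart_vec W \<psi> p a"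
      unfolding tangent_space_def chart_vec_def by auto
    then show "v \<in> range (chart_vec U \<phi> p)" using chart_vec_change assms by blast
  qed
qed

lemma tangent_space_lin:
  assumes "u \<in> T p" "v \<in> T p"
  shows "(\<lambda>f. c * u f + v f) \<in> T p"
proof -
  obtain U \<phi> where U: "(U, \<phi>) \<in> A" "p \<in> U" using ex_chart by blast
  then obtain a b where "u = chart_vec U \<phi> p a" "v = chart_vec U \<phi> p b"
    using assms tangent_space_chart by blast
  then show ?thesis
    using chart_vec_linear[OF U, of c a b] tangent_space_chart[OF U] by (metis rangeI)
qed

lemma tangent_const:
  assumes "v \<in> T p"
  shows "v (\<lambda>_. c) = 0"
proof -
  obtain U \<phi> where U: "(U, \<phi>) \<in> A" "p \<in> U" using ex_chart by blast
  then obtain a where "v = chart_vec U \<phi> p a" using assms tangent_space_chart by blast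
  then show ?thesis using smooth_const[of c] by (simp add: chart_vec_def comp_def)
qed

lemma tangent_scale:
  assumes "v \<in> T p" "f \<in> S"
  shows "v (\<lambda>x. c * f x) = c * v f"
proof -
  obtain U \<phi> where U: "(U, \<phi>) \<in> A" "p \<in> U" using ex_chart by blast
  then obtain a where a: "v = chart_vec U \<phi> p a" using assms tangent_space_chart by blast
  have "((f \<circ> inv_into U \<phi>) has_derivative frechet_derivative (f \<circ> inv_into U \<phi>) (at (\<phi> p))) (at (\<phi> p))"
    using chart_differentiable[OF assms(2) U] by (simp add: frechet_derivative_works)
  from has_derivative_mult_right[OF this, of c]
  have "frechet_derivative ((\<lambda>x. c * f x) \<circ> inv_into U \<phi>) (at (\<phi> p))
     = (\<lambda>x. c * frechet_derivative (f \<circ> inv_into U \<phi>) (at (\<phi> p)) x)"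
    by (simp add: comp_def frechet_derivative_at[symmetric])
  then show ?thesis
    using a assms(2) smooth_mult[OF smooth_const assms(2), of c] by (simp add: chart_vec_def)
qed

lemma vf_tangent: "X \<in> V \<Longrightarrow> X p \<in> T p"
  by (simp add: vector_fields_def)

lemma vf_smooth: "X \<in> V \<Longrightarrow> f \<in> S \<Longrightarrow> vf_apply X f \<in> S"
  by (simp add: vector_fields_def)

lemma vf_lin:
  assumes "h \<in> S" "X \<in> V" "Y \<in> V"
  shows "h \<star> X + Y \<in> V"
proof -
  have "(h \<star> X + Y) p \<in> T p" for p
    using tangent_space_lin[OF vf_tangent[OF assms(2)] vf_tangent[OF assms(3)], of "h p" p]
    by (simp add: vf_scale_def plus_fun_def)
  moreover have "vf_apply (h \<star> X + Y) f \<in> S" if "f \<in> S" for f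
    using smooth_add[OF smooth_mult[OF assms(1) vf_smooth[OF assms(2) that]] vf_smooth[OF assms(3) that]]
    by (simp add: vf_apply_def vf_scale_def)
  ultimately show ?thesis by (simp add: vector_fields_def)
qed

lemma vf_diff: "X \<in> V \<Longrightarrow> Y \<in> V \<Longrightarrow> X - Y \<in> V"
  using vf_lin[OF smooth_const, of Y X "-1"]
  by (simp add: vf_scale_def fun_diff_def plus_fun_def)

lemma vf_add: "X \<in> V \<Longrightarrow> Y \<in> V \<Longrightarrow> X + Y \<in> V"
  using vf_lin[OF smooth_const, of X Y "1"]
  by (simp add: vf_scale_def)

lemma vf_scale: "h \<in> S \<Longrightarrow> X \<in> V \<Longrightarrow> h \<star> X \<in> V"
  \<comment> \<open>\<open>X - X\<close> is the zero field in a form already known to lie in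
    \<open>V\<close>.\<close>
  using vf_lin[of h X "X - X"] vf_diff[of X X] by simp

end

section \<open>Pseudo-orthonormal frames\<close>

locale lorentzian_frame = smooth_mfd A
  for A :: "('a::{t2_space,second_countable_topology}, real^3) atlas" +
  fixes g :: "'a metric" and e1 e2 e3 :: "'a vfield"
  assumes metric: "lorentzian_metric_3 A g"
    and frame_vf: "e1 \<in> V" "e2 \<in> V" "e3 \<in> V"
    and orthonormal: "pseudo_orthonormal (g p) (e1 p) (e2 p) (e3 p)"
begin

lemma g_sym: "u \<in> T p \<Longrightarrow> v \<in> T p \<Longrightarrow> g p u v = g p v u"
  using metric by (simp add: lorentzian_metric_3_def)

lemma g_lin:
  "u \<in> T p \<Longrightarrow> v \<in> T p \<Longrightarrow> w \<in> T p \<Longrightarrow> g p (\<lambda>f. c * u f + v f) w = c * g p u w + g p v w"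
  using metric by (simp add: lorentzian_metric_3_def)

lemma metric_smooth: "X \<in> V \<Longrightarrow> Y \<in> V \<Longrightarrow> metric_apply g X Y \<in> S"
  using metric by (simp add: lorentzian_metric_3_def)

lemma metric_sym: "X \<in> V \<Longrightarrow> Y \<in> V \<Longrightarrow> metric_apply g X Y = metric_apply g Y X"
  by (simp add: metric_apply_def g_sym vf_tangent)

lemma metric_lin:
  assumes "X \<in> V" "Y \<in> V" "Z \<in> V"
  shows "metric_apply g (h \<star> X + Y) Z p = h p * metric_apply g X Z p + metric_apply g Y Z p"
  using g_lin[of "X p" p "Y p" "Z p" "h p"] vf_tangent assms
  by (simp add: metric_apply_def vf_scale_def plus_fun_def)

lemma metric_add:
  assumes "X \<in> V" "Y \<in> V" "Z \<in> V"
  shows "metric_apply g (X + Y) Z p = metric_apply g X Z p + metric_apply g Y Z p"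
  using metric_lin[OF assms, of "\<lambda>_. 1"] by (simp add: vf_scale_def)

lemma metric_diff:
  assumes "X \<in> V" "Y \<in> V" "Z \<in> V"
  shows "metric_apply g (X - Y) Z p = metric_apply g X Z p - metric_apply g Y Z p"
  using metric_add[of "X - Y" Y Z p] vf_diff assms by simp

lemma metric_zero: "Z \<in> V \<Longrightarrow> metric_apply g 0 Z = 0"
  using metric_diff[of Z Z Z] by (simp add: fun_eq_iff)

lemma metric_scale:
  assumes "X \<in> V" "Z \<in> V"
  shows "metric_apply g (h \<star> X) Z p = h p * metric_apply g X Z p"
  using metric_lin[of X 0 Z h p] metric_zero[of Z] vf_diff[of X X] assms by simp

text \<open>Equalities of functions rather than of values at a point: \<open>connection_skew\<close>
  differentiates these constants.\<close>

lemma frame_metric: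
  "metric_apply g e1 e1 = (\<lambda>_. 1)" "metric_apply g e2 e2 = (\<lambda>_. 1)" "metric_apply g e3 e3 = (\<lambda>_. - 1)"
  "metric_apply g e1 e2 = (\<lambda>_. 0)" "metric_apply g e2 e1 = (\<lambda>_. 0)" "metric_apply g e1 e3 = (\<lambda>_. 0)"
  "metric_apply g e3 e1 = (\<lambda>_. 0)" "metric_apply g e2 e3 = (\<lambda>_. 0)" "metric_apply g e3 e2 = (\<lambda>_. 0)"
  using orthonormal unfolding pseudo_orthonormal_def metric_apply_def by simp_all

lemma metric_frame_comb:
  assumes "Z \<in> V"
  shows "metric_apply g ((\<lambda>_. a) \<star> e1 + ((\<lambda>_. b) \<star> e2 + (\<lambda>_. c) \<star> e3)) Z p
    = a * metric_apply g e1 Z p + b * metric_apply g e2 Z p + c * metric_apply g e3 Z p"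
  using assms frame_vf by (simp add: metric_add metric_scale vf_add vf_scale smooth_const)

text \<open>All charts around a point induce the same tangent space, so it has dimension 3 and the
  linearly independent frame spans it.\<close>

lemma tangent_frame_expansion:
  assumes "u \<in> T p"
  shows "\<exists>a b c. u = ((\<lambda>_. a) \<star> e1 + ((\<lambda>_. b) \<star> e2 + (\<lambda>_. c) \<star> e3)) p"
proof -
  obtain U \<phi> where U: "(U, \<phi>) \<in> A" "p \<in> U" using ex_chart by blast
  let ?L = "chart_vec U \<phi> p"
  have L: "?L (c *\<^sub>R a + b) = (\<lambda>f. c * ?L a f + ?L b f)" for a b c
    by (rule chart_vec_linear[OF U])
  have "\<exists>a. X p = ?L a" if "X \<in> V" for X
    using vf_tangent[OF that] tangent_space_chart[OF U] by blast
  then obtain a1 a2 a3 where a: "e1 p = ?L a1" "e2 p = ?L a2" "e3 p = ?L a3"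
    using frame_vf by meson
  have L0: "?L 0 = (\<lambda>_. 0)"
    using L[of "-1" 0 0] by simp
  \<comment> \<open>\<open>h\<close> sends frame coefficients to chart coordinates. The trailing
    \<open>0\<close> gives every summand the shape in which \<open>L\<close> rewrites.\<close>
  define h :: "real^3 \<Rightarrow> real^3" where "h c = c$1 *\<^sub>R a1 + (c$2 *\<^sub>R a2 + (c$3 *\<^sub>R a3 + 0))" for c
  have Lh: "?L (h c) = ((\<lambda>_. c$1) \<star> e1 + ((\<lambda>_. c$2) \<star> e2 + (\<lambda>_. c$3) \<star> e3)) p" for c
    unfolding h_def L L0 by (simp add: vf_scale_def plus_fun_def a)
  have lin: "linear h"
    by (rule linearI) (simp_all add: h_def algebra_simps)
  have "c = 0" if "h c = 0" for c
  proof -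
    let ?C = "(\<lambda>_. c$1) \<star> e1 + ((\<lambda>_. c$2) \<star> e2 + (\<lambda>_. c$3) \<star> e3)"
    \<comment> \<open>Pairing the combination with e1, e2, e3 returns its coefficients up to sign,
      so the kernel of \<open>h\<close> is trivial.\<close>
    have "?C p = (0 :: 'a vfield) p"
      using Lh[of c] that L0 by (simp only: zero_fun_def)
    then have "metric_apply g ?C Z p = 0" if "Z \<in> V" for Z
      using fun_cong[OF metric_zero[OF that], of p] by (simp only: metric_apply_def zero_fun_def)
    from this[OF frame_vf(1)] this[OF frame_vf(2)] this[OF frame_vf(3)]
    have "c$1 = 0" "c$2 = 0" "c$3 = 0"
      using frame_vf by (simp_all add: metric_frame_comb frame_metric)
    then show ?thesis by (simp add: vec_eq_iff forall_3)
  qed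
  then have "inj h" using linear_injective_0[OF lin] by blast
  then have "surj h" using linear_injective_imp_surjective[OF lin] by blast
  moreover obtain a where "u = ?L a" using assms tangent_space_chart[OF U] by blast
  ultimately show ?thesis using Lh by (metis surjD)
qed

text \<open>The minus sign comes from g(e3, e3) = -1. Writing the coefficients as metric products
  shows that they are smooth, so the rules for \<open>D\<close> apply to them.\<close>

lemma frame_expansion:
  assumes "X \<in> V"
  shows "X = metric_apply g X e1 \<star> e1 + (metric_apply g X e2 \<star> e2 + (\<lambda>p. - metric_apply g X e3 p) \<star> e3)"
proof
  fix p
  obtain a b c where abc: "X p = ((\<lambda>_. a) \<star> e1 + ((\<lambda>_. b) \<star> e2 + (\<lambda>_. c) \<star> e3)) p"
    using tangent_frame_expansion[OF vf_tangent[OF assms]] by blast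
  let ?C = "(\<lambda>_. a) \<star> e1 + ((\<lambda>_. b) \<star> e2 + (\<lambda>_. c) \<star> e3)"
  have "metric_apply g X Z p = metric_apply g ?C Z p" for Z
    by (simp only: metric_apply_def abc)
  then have "metric_apply g X e1 p = a" "metric_apply g X e2 p = b" "metric_apply g X e3 p = - c"
    using frame_vf by (simp_all add: metric_frame_comb frame_metric)
  then show "X p = (metric_apply g X e1 \<star> e1 + (metric_apply g X e2 \<star> e2
      + (\<lambda>p. - metric_apply g X e3 p) \<star> e3)) p"
    by (simp add: abc vf_scale_def)
qed

lemma metric_neg_smooth: "X \<in> V \<Longrightarrow> Y \<in> V \<Longrightarrow> (\<lambda>p. - metric_apply g X Y p) \<in> S"
  using smooth_mult[OF smooth_const[of "-1"] metric_smooth] by simp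

lemmas frame_coeff_smooth = metric_smooth metric_neg_smooth

end

section \<open>The canonical connection\<close>

locale canonical_frame = lorentzian_frame A g e1 e2 e3
  for A :: "('a::{t2_space,second_countable_topology}, real^3) atlas"
    and g :: "'a metric" and e1 e2 e3 :: "'a vfield" +
  fixes J :: "'a endo" and D :: "'a connection" and \<alpha> \<beta> \<gamma> \<delta> :: real
  assumes brackets: "lie_bracket e1 e2 = 0"
      "lie_bracket e1 e3 = (\<lambda>_. \<alpha>) \<star> e1 + (\<lambda>_. \<beta>) \<star> e2"
      "lie_bracket e2 e3 = (\<lambda>_. \<gamma>) \<star> e1 + (\<lambda>_. \<delta>) \<star> e2"
    and tensor: "tensor_11 A J"
    and J_involution: "X \<in> V \<Longrightarrow> endo_apply J (endo_apply J X) = X"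
    and J_frame: "endo_apply J e1 = e1" "endo_apply J e2 = e2" "endo_apply J e3 = - e3"
    and levi_civita: "levi_civita_connection A g D"
begin

abbreviation "D0 \<equiv> canonical_connection D J"

lemma J_vf: "X \<in> V \<Longrightarrow> endo_apply J X \<in> V"
  using tensor by (simp add: tensor_11_def)

text \<open>\<open>tensor_11\<close> gives linearity in each tangent space; the scalar
  \<open>h p\<close> at each p turns it into linearity over functions.\<close>

lemma J_lin:
  assumes "X \<in> V" "Y \<in> V"
  shows "endo_apply J (h \<star> X + Y) = h \<star> endo_apply J X + endo_apply J Y"
proof
  fix p
  have "J p (\<lambda>f. h p * X p f + Y p f) = (\<lambda>f. h p * J p (X p) f + J p (Y p) f)"
    using tensor vf_tangent[OF assms(1), of p] vf_tangent[OF assms(2), of p]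
    unfolding tensor_11_def by blast
  then show "endo_apply J (h \<star> X + Y) p = (h \<star> endo_apply J X + endo_apply J Y) p"
    by (simp add: endo_apply_def vf_scale_def plus_fun_def)
qed

lemma J_add: "X \<in> V \<Longrightarrow> Y \<in> V \<Longrightarrow> endo_apply J (X + Y) = endo_apply J X + endo_apply J Y"
  using J_lin[of X Y "\<lambda>_. 1"] by (simp add: vf_scale_def)

lemma J_zero: "endo_apply J 0 = 0"
  using J_add[of "e1 - e1" "e1 - e1"] vf_diff[OF frame_vf(1) frame_vf(1)] by simp

lemma J_scale: "X \<in> V \<Longrightarrow> endo_apply J (h \<star> X) = h \<star> endo_apply J X"
  using J_lin[of X "X - X" h] vf_diff[of X X] by (simp add: J_zero)

section \<open>Calculus of the Levi-Civita connection and of the canonical connection\<close>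

lemma D_vf: "X \<in> V \<Longrightarrow> Y \<in> V \<Longrightarrow> D X Y \<in> V"
  and D_add1: "X \<in> V \<Longrightarrow> X' \<in> V \<Longrightarrow> Y \<in> V \<Longrightarrow> D (X + X') Y = D X Y + D X' Y"
  and D_scale1: "h \<in> S \<Longrightarrow> X \<in> V \<Longrightarrow> Y \<in> V \<Longrightarrow> D (h \<star> X) Y = h \<star> D X Y"
  and D_add2: "X \<in> V \<Longrightarrow> Y \<in> V \<Longrightarrow> Y' \<in> V \<Longrightarrow> D X (Y + Y') = D X Y + D X Y'"
  and D_Leibniz: "h \<in> S \<Longrightarrow> X \<in> V \<Longrightarrow> Y \<in> V \<Longrightarrow> D X (h \<star> Y) = h \<star> D X Y + vf_apply X h \<star> Y"
  using levi_civita by (simp_all add: levi_civita_connection_def affine_connection_def)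

lemma D_torsion: "X \<in> V \<Longrightarrow> Y \<in> V \<Longrightarrow> lie_bracket X Y = D X Y - D Y X"
  using levi_civita by (simp add: levi_civita_connection_def)

lemma D_metric: "X \<in> V \<Longrightarrow> Y \<in> V \<Longrightarrow> Z \<in> V \<Longrightarrow> vf_apply X (metric_apply g Y Z) p
    = metric_apply g (D X Y) Z p + metric_apply g Y (D X Z) p"
  using levi_civita by (simp add: levi_civita_connection_def)

lemma bracket_vf: "X \<in> V \<Longrightarrow> Y \<in> V \<Longrightarrow> lie_bracket X Y \<in> V"
  by (simp add: D_torsion D_vf vf_diff)

lemma vf_const: "X \<in> V \<Longrightarrow> vf_apply X (\<lambda>_. c) = (\<lambda>_. 0)"
  unfolding vf_apply_def by (rule ext) (rule tangent_const[OF vf_tangent])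

lemma D_expand1:
  assumes "X \<in> V" "Y \<in> V"
  shows "D X Y = metric_apply g X e1 \<star> D e1 Y
    + (metric_apply g X e2 \<star> D e2 Y + (\<lambda>p. - metric_apply g X e3 p) \<star> D e3 Y)"
  by (subst frame_expansion[OF assms(1)])
    (use assms frame_vf in \<open>simp only: D_add1 D_scale1 frame_coeff_smooth vf_scale vf_add\<close>)

text \<open>As J is an involution, (D_X J)(J Y) = D_X Y - J (D_X (J Y)). Hence \<open>D0\<close> is
  the average of \<open>D\<close> and its conjugate by J.\<close>

lemma D0_eq:
  assumes "X \<in> V" "Y \<in> V"
  shows "D0 X Y = D X Y - (\<lambda>_. 1/2) \<star> (D X Y - endo_apply J (D X (endo_apply J Y)))"
  using assms by (simp add: canonical_connection_def deriv_endo_def J_involution)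

lemma D0_vf: "X \<in> V \<Longrightarrow> Y \<in> V \<Longrightarrow> D0 X Y \<in> V"
  by (simp add: D0_eq D_vf J_vf vf_diff vf_scale smooth_const)

lemma D0_add:
  assumes "X \<in> V" "Y \<in> V" "Z \<in> V"
  shows "D0 X (Y + Z) = D0 X Y + D0 X Z"
  using assms
  by (simp add: D0_eq vf_add J_add J_vf D_add2 D_vf fun_eq_iff vf_scale_def algebra_simps)

lemma D0_Leibniz:
  assumes "h \<in> S" "X \<in> V" "Y \<in> V"
  shows "D0 X (h \<star> Y) = h \<star> D0 X Y + vf_apply X h \<star> Y"
  using assms
  by (simp add: D0_eq vf_scale J_scale J_lin J_vf D_Leibniz D_vf vf_smooth J_involution)
    (simp add: fun_eq_iff vf_scale_def field_simps)

text \<open>J e3 = - e3 cancels the minus sign of the third coefficient in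
  \<open>frame_expansion\<close>.\<close>

lemma J_expansion:
  assumes "Z \<in> V"
  shows "endo_apply J Z = metric_apply g Z e1 \<star> e1
    + (metric_apply g Z e2 \<star> e2 + metric_apply g Z e3 \<star> e3)"
  by (subst frame_expansion[OF assms])
    (use assms frame_vf in \<open>simp add: J_add J_scale frame_coeff_smooth vf_scale vf_add J_frame,
      simp add: fun_eq_iff vf_scale_def\<close>)

section \<open>The connection form of the induced connection on span(e1, e2)\<close>

definition \<omega> :: "'a vfield \<Rightarrow> 'a \<Rightarrow> real" where "\<omega> X = metric_apply g (D X e1) e2"

text \<open>The metric dual of e3, with value -1 on e3; hence \<beta> - \<gamma> in
  \<open>\<omega>_eq\<close> against \<gamma> - \<beta> in \<open>\<omega>_frame\<close>.\<close>

abbreviation \<theta> :: "'a vfield \<Rightarrow> 'a \<Rightarrow> real" where "\<theta> X \<equiv> metric_apply g X e3"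

text \<open>Metric compatibility applied to the constant function g(e, e').\<close>

lemma connection_skew:
  assumes "X \<in> V" "e \<in> {e1, e2, e3}" "e' \<in> {e1, e2, e3}"
  shows "metric_apply g (D X e) e' p = - metric_apply g (D X e') e p"
proof -
  have e: "e \<in> V" "e' \<in> V" using assms frame_vf by auto
  have "\<exists>c. metric_apply g e e' = (\<lambda>_. c)"
    using assms(2,3) frame_metric by auto
  then have "vf_apply X (metric_apply g e e') p = 0"
    using vf_const[OF assms(1)] by force
  then show ?thesis
    using D_metric[OF assms(1) e] metric_sym[OF e(1) D_vf[OF assms(1) e(2)]] by simp
qed

lemma connection_self:
  assumes "X \<in> V" "e \<in> {e1, e2, e3}"
  shows "metric_apply g (D X e) e p = 0"
  using connection_skew[OF assms assms(2), of p] by simp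

lemma D0_frame:
  assumes "X \<in> V"
  shows "D0 X e1 = \<omega> X \<star> e2" "D0 X e2 = (\<lambda>p. - \<omega> X p) \<star> e1" "D0 X e3 = 0"
proof -
  \<comment> \<open>(Z - J Z) / 2 is the projection of Z to the line of e3; \<open>half'\<close> is
    the complementary projection to span(e1, e2).\<close>
  have half: "(\<lambda>_. 1/2) \<star> (Z - endo_apply J Z) = (\<lambda>p. - metric_apply g Z e3 p) \<star> e3" if "Z \<in> V" for Z
    unfolding J_expansion[OF that] by (subst (1) frame_expansion[OF that])
     (simp add: fun_eq_iff vf_scale_def)
  have half': "Z - (\<lambda>_. 1/2) \<star> (Z - endo_apply J Z)
      = metric_apply g Z e1 \<star> e1 + metric_apply g Z e2 \<star> e2" if "Z \<in> V" for Z
    unfolding half[OF that] by (subst (1) frame_expansion[OF that])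
     (simp add: fun_eq_iff vf_scale_def)
  note Dv = D_vf[OF assms frame_vf(1)] D_vf[OF assms frame_vf(2)] D_vf[OF assms frame_vf(3)]
  show "D0 X e1 = \<omega> X \<star> e2"
    unfolding D0_eq[OF assms frame_vf(1)] J_frame half'[OF Dv(1)]
    using connection_self[OF assms, of e1] by (simp add: \<omega>_def fun_eq_iff vf_scale_def)
  show "D0 X e2 = (\<lambda>p. - \<omega> X p) \<star> e1"
    unfolding D0_eq[OF assms frame_vf(2)] J_frame half'[OF Dv(2)]
    using connection_self[OF assms, of e2] connection_skew[OF assms, of e2 e1]
    by (simp add: \<omega>_def fun_eq_iff vf_scale_def)
  have m: "- Z = (\<lambda>_. - 1) \<star> Z" for Z :: "'a vfield" by (simp add: fun_eq_iff vf_scale_def)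
  have "D X (- e3) = (\<lambda>_. - 1) \<star> D X e3"
    unfolding m using D_Leibniz[OF smooth_const assms frame_vf(3), of "-1"]
    by (simp add: vf_const[OF assms]) (simp add: fun_eq_iff vf_scale_def)
  then have "endo_apply J (D X (endo_apply J e3)) = - endo_apply J (D X e3)"
    using J_scale[OF Dv(3), of "\<lambda>_. - 1"] by (simp only: J_frame m[symmetric])
  \<comment> \<open>Two sign changes, J e3 = - e3 and the minus in \<open>D0_eq\<close>, leave the
    e3-part of \<open>D X e3\<close>, which is zero because e3 has constant norm.\<close>
  then have "D0 X e3 = (\<lambda>_. 1/2) \<star> (D X e3 - endo_apply J (D X e3))"
    unfolding D0_eq[OF assms frame_vf(3)] by (simp add: fun_eq_iff vf_scale_def field_simps)
  also have "\<dots> = 0"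
    unfolding half[OF Dv(3)] using connection_self[OF assms, of e3]
    by (simp add: fun_eq_iff vf_scale_def)
  finally show "D0 X e3 = 0" .
qed

lemma frame_torsion:
  assumes "e \<in> {e1, e2, e3}" "e' \<in> {e1, e2, e3}" "Z \<in> V"
  shows "metric_apply g (lie_bracket e e') Z p = metric_apply g (D e e') Z p - metric_apply g (D e' e) Z p"
proof -
  have "e \<in> V" "e' \<in> V" using assms frame_vf by auto
  then show ?thesis using assms(3) by (simp add: D_torsion metric_diff D_vf)
qed

lemma bracket_metric:
  "Z \<in> V \<Longrightarrow> metric_apply g (lie_bracket e1 e2) Z p = 0"
  "Z \<in> V \<Longrightarrow> metric_apply g (lie_bracket e1 e3) Z p = \<alpha> * metric_apply g e1 Z p + \<beta> * metric_apply g e2 Z p"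
  "Z \<in> V \<Longrightarrow> metric_apply g (lie_bracket e2 e3) Z p = \<gamma> * metric_apply g e1 Z p + \<delta> * metric_apply g e2 Z p"
  unfolding brackets
  using frame_vf by (simp_all add: metric_zero metric_add metric_scale vf_scale smooth_const)

text \<open>Koszul's formula by elimination: skewness \<open>sk\<close> and torsion
  \<open>to\<close>, paired with frame vectors, are linear equations for the connection
  coefficients.\<close>

lemma \<omega>_frame: "\<omega> e1 p = 0" "\<omega> e2 p = 0" "\<omega> e3 p = (\<gamma> - \<beta>) / 2"
proof -
  note fv = frame_vf
  have sk: "metric_apply g (D e e1) e1 p = 0" "metric_apply g (D e e2) e2 p = 0"
    "metric_apply g (D e e2) e1 p = - metric_apply g (D e e1) e2 p"
    "metric_apply g (D e e3) e1 p = - metric_apply g (D e e1) e3 p"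
    "metric_apply g (D e e3) e2 p = - metric_apply g (D e e2) e3 p" if "e \<in> V" for e
    using connection_self[OF that, of e1 p] connection_self[OF that, of e2 p]
      connection_skew[OF that, of e2 e1 p] connection_skew[OF that, of e3 e1 p]
      connection_skew[OF that, of e3 e2 p] by simp_all
  have to: "metric_apply g (D e1 e2) Z p - metric_apply g (D e2 e1) Z p = 0"
    "metric_apply g (D e1 e3) Z p - metric_apply g (D e3 e1) Z p
      = \<alpha> * metric_apply g e1 Z p + \<beta> * metric_apply g e2 Z p"
    "metric_apply g (D e2 e3) Z p - metric_apply g (D e3 e2) Z p
      = \<gamma> * metric_apply g e1 Z p + \<delta> * metric_apply g e2 Z p" if "Z \<in> V" for Z
    using frame_torsion[of e1 e2, OF _ _ that, of p] frame_torsion[of e1 e3, OF _ _ that, of p]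
      frame_torsion[of e2 e3, OF _ _ that, of p] bracket_metric[OF that, of p] by simp_all
  note t1 = to[OF fv(1), unfolded frame_metric] and t2 = to[OF fv(2), unfolded frame_metric]
    and t3 = to[OF fv(3), unfolded frame_metric]
  note s1 = sk[OF fv(1)] and s2 = sk[OF fv(2)] and s3 = sk[OF fv(3)]
  show "\<omega> e1 p = 0" using t1(1) s1(3) s2(1) unfolding \<omega>_def by linarith
  show "\<omega> e2 p = 0" using t2(1) s1(2) unfolding \<omega>_def by linarith
  \<comment> \<open>As [e1, e2] = 0, the products g(D_e1 e3, e2) and g(D_e2 e3, e1) have a common
    value x. The brackets with e3 give x - \<omega>(e3) = \<beta> and x + \<omega>(e3) =
    \<gamma>.\<close>
  show "\<omega> e3 p = (\<gamma> - \<beta>) / 2"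
    using t2(2) t1(3) t3(1) s3(3) s1(5) s2(4) unfolding \<omega>_def by simp
qed

text \<open>\<omega> is linear over functions, and in the expansion of X only the e3-term, with
  coefficient - \<theta>(X), contributes.\<close>

lemma \<omega>_eq:
  assumes "X \<in> V"
  shows "\<omega> X = (\<lambda>p. (\<beta> - \<gamma>) / 2 * \<theta> X p)"
proof
  fix p
  have "\<omega> X p = metric_apply g X e1 p * \<omega> e1 p + (metric_apply g X e2 p * \<omega> e2 p + - \<theta> X p * \<omega> e3 p)"
    unfolding \<omega>_def by (subst D_expand1[OF assms frame_vf(1)])
      (use assms frame_vf in \<open>simp add: metric_add metric_scale D_vf vf_add vf_scale frame_coeff_smooth\<close>)
  then show "\<omega> X p = (\<beta> - \<gamma>) / 2 * \<theta> X p"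
    by (simp add: \<omega>_frame field_simps)
qed

section \<open>Closedness of \<theta> and \<omega>\<close>

lemma frame_hessian_sym:
  assumes "e \<in> {e1, e2, e3}" "e' \<in> {e1, e2, e3}" "metric_apply g (lie_bracket e e') e3 p = 0"
  shows "metric_apply g (D e e3) e' p = metric_apply g (D e' e3) e p"
proof -
  have v: "e \<in> V" "e' \<in> V" using assms frame_vf by auto
  show ?thesis
    \<comment> \<open>By skewness the two sides differ, up to sign, by g([e, e'], e3).\<close>
    using connection_skew[OF v(1), of e3 e' p] connection_skew[OF v(2), of e3 e p]
      frame_torsion[OF assms(1,2) frame_vf(3), of p] assms by simp
qed

text \<open>The form (X, Y) -> g(D_X e3, Y) is bilinear over functions, so symmetry on frame pairs
  suffices: \<open>ex\<close> expands the first argument, \<open>ey\<close> the second. The pairs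
  are symmetric because no bracket has an e3-component.\<close>

lemma hessian_sym:
  assumes "X \<in> V" "Y \<in> V"
  shows "metric_apply g (D X e3) Y p = metric_apply g (D Y e3) X p"
proof -
  have ex: "metric_apply g (D X e3) Y p =
      metric_apply g X e1 p * metric_apply g (D e1 e3) Y p
      + (metric_apply g X e2 p * metric_apply g (D e2 e3) Y p
      + - metric_apply g X e3 p * metric_apply g (D e3 e3) Y p)" if "X \<in> V" "Y \<in> V" for X Y
    by (subst D_expand1[OF that(1) frame_vf(3)])
      (use that frame_vf in \<open>simp add: metric_add metric_scale D_vf vf_add vf_scale frame_coeff_smooth\<close>)
  have ey: "metric_apply g Z Y p = metric_apply g Y e1 p * metric_apply g Z e1 p
      + (metric_apply g Y e2 p * metric_apply g Z e2 p
      + - metric_apply g Y e3 p * metric_apply g Z e3 p)" if "Z \<in> V" "Y \<in> V" for Z Y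
  proof -
    have "metric_apply g Z Y p = metric_apply g Y Z p" by (simp only: metric_sym[OF that])
    also have "\<dots> = metric_apply g Y e1 p * metric_apply g e1 Z p
      + (metric_apply g Y e2 p * metric_apply g e2 Z p + - metric_apply g Y e3 p * metric_apply g e3 Z p)"
      by (subst frame_expansion[OF that(2)])
        (use that frame_vf in \<open>simp add: metric_add metric_scale vf_add vf_scale frame_coeff_smooth\<close>)
    finally show ?thesis
      by (simp only: metric_sym[OF frame_vf(1) that(1)] metric_sym[OF frame_vf(2) that(1)]
        metric_sym[OF frame_vf(3) that(1)])
  qed
  show ?thesis
    unfolding ex[OF assms] ex[OF assms(2,1)]
    using frame_hessian_sym[of e1 e2 p] frame_hessian_sym[of e1 e3 p]
      frame_hessian_sym[of e2 e3 p] bracket_metric[OF frame_vf(3), of p]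
    by (simp add: ey[OF _ assms(1)] ey[OF _ assms(2)] D_vf frame_vf frame_metric algebra_simps)
qed

text \<open>Metric compatibility and vanishing torsion turn d\<theta>(X, Y) into g(D_X e3, Y) -
  g(D_Y e3, X), which \<open>hessian_sym\<close> makes zero.\<close>

lemma \<theta>_closed:
  assumes "X \<in> V" "Y \<in> V"
  shows "vf_apply X (\<theta> Y) p - vf_apply Y (\<theta> X) p = \<theta> (lie_bracket X Y) p"
  using assms frame_vf hessian_sym[OF assms, of p]
  by (simp add: D_metric D_torsion metric_diff D_vf metric_sym[OF _ D_vf])

lemma \<omega>_smooth: "X \<in> V \<Longrightarrow> \<omega> X \<in> S"
  by (simp add: \<omega>_def metric_smooth D_vf frame_vf)

lemma \<omega>_closed:
  assumes "X \<in> V" "Y \<in> V"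
  shows "vf_apply X (\<omega> Y) p - vf_apply Y (\<omega> X) p = \<omega> (lie_bracket X Y) p"
proof -
  have "vf_apply Z (\<omega> W) p = (\<beta> - \<gamma>) / 2 * vf_apply Z (\<theta> W) p" if "Z \<in> V" "W \<in> V" for Z W
    unfolding \<omega>_eq[OF that(2)] vf_apply_def
    by (rule tangent_scale[OF vf_tangent[OF that(1)] metric_smooth[OF that(2) frame_vf(3)]])
  then show ?thesis
    using \<theta>_closed[OF assms, of p] assms
    by (simp add: \<omega>_eq bracket_vf flip: right_diff_distrib)
qed

section \<open>Flatness of the canonical connection and its Ricci tensor\<close>

lemma curvature_add:
  assumes "X \<in> V" "Y \<in> V" "Z \<in> V" "W \<in> V"
  shows "curvature D0 X Y (Z + W) = curvature D0 X Y Z + curvature D0 X Y W"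
  using assms by (simp add: curvature_def D0_add D0_vf bracket_vf)

text \<open>The terms with one derivative of h cancel in pairs, and X(Y h) - Y(X h) cancels against
  [X, Y] h, for which \<open>lie_bracket\<close> is unfolded.\<close>

lemma curvature_scale:
  assumes "h \<in> S" "X \<in> V" "Y \<in> V" "Z \<in> V"
  shows "curvature D0 X Y (h \<star> Z) = h \<star> curvature D0 X Y Z"
  using assms
  by (simp add: curvature_def D0_add D0_Leibniz D0_vf bracket_vf vf_scale vf_smooth)
    (simp add: fun_eq_iff vf_scale_def lie_bracket_def vf_apply_def algebra_simps)

text \<open>Since \<omega> is the form of a rotation in a plane, the products \<omega>(X)
  \<omega>(Y) cancel. What remains on e1 and e2 is d\<omega>(X, Y), up to sign, times the other
  vector.\<close>

lemma curvature_frame: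
  assumes "X \<in> V" "Y \<in> V"
  shows "curvature D0 X Y e1 = 0" "curvature D0 X Y e2 = 0" "curvature D0 X Y e3 = 0"
proof -
  have neg: "(\<lambda>p. - \<omega> Z p) \<in> S" if "Z \<in> V" for Z
    using smooth_mult[OF smooth_const[of "-1"] \<omega>_smooth[OF that]] by simp
  have vneg: "vf_apply Z (\<lambda>p. - \<omega> W p) p = - vf_apply Z (\<omega> W) p" if "Z \<in> V" "W \<in> V" for Z W p
    using tangent_scale[OF vf_tangent[OF that(1)] \<omega>_smooth[OF that(2)], of p "-1"]
    by (simp add: vf_apply_def)
  show "curvature D0 X Y e1 = 0"
    using assms frame_vf \<omega>_closed[OF assms]
    by (simp add: curvature_def D0_frame bracket_vf D0_Leibniz \<omega>_smooth)
      (simp add: fun_eq_iff vf_scale_def flip: left_diff_distrib)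
  show "curvature D0 X Y e2 = 0"
    using assms frame_vf
    by (simp add: curvature_def D0_frame bracket_vf D0_Leibniz neg)
      (simp add: fun_eq_iff vf_scale_def vneg algebra_simps flip: \<omega>_closed[OF assms])
  have "D0 Z 0 = 0" if "Z \<in> V" for Z
    using D0_add[OF that, of "e1 - e1" "e1 - e1"] vf_diff[OF frame_vf(1) frame_vf(1)] by simp
  then show "curvature D0 X Y e3 = 0"
    using assms by (simp add: curvature_def D0_frame bracket_vf)
qed

lemma curvature_zero:
  assumes "X \<in> V" "Y \<in> V" "Z \<in> V"
  shows "curvature D0 X Y Z = 0"
  by (subst frame_expansion[OF assms(3)])
    (use assms frame_vf in \<open>simp add: curvature_add curvature_scale curvature_frame
      frame_coeff_smooth vf_scale vf_add, simp add: fun_eq_iff vf_scale_def\<close>)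

lemma ricci_zero:
  assumes "X \<in> V" "Y \<in> V"
  shows "ricci g D0 e1 e2 e3 X Y = 0"
  using assms frame_vf by (simp add: ricci_def curvature_zero metric_zero)

lemma lie_derivative_ricci_zero:
  assumes "\<xi> \<in> V" "X \<in> V" "Y \<in> V"
  shows "lie_derivative_02 \<xi> (symmetrized (ricci g D0 e1 e2 e3)) X Y = 0"
proof -
  \<comment> \<open>As a constant function, so that \<open>vf_const\<close> removes the derivative
    along \<xi>; the bracket terms are covered because brackets stay in \<open>V\<close>.\<close>
  have "symmetrized (ricci g D0 e1 e2 e3) Z W = (\<lambda>_. 0)" if "Z \<in> V" "W \<in> V" for Z W
    using that by (simp add: symmetrized_def ricci_zero)
  then show ?thesis
    using assms by (simp add: lie_derivative_02_def bracket_vf vf_const)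
      (simp add: fun_eq_iff)
qed

end

section \<open>Application to the Lie group\<close>

theorem theorem4p3:
  fixes \<alpha> \<beta> \<gamma> \<delta> :: real
    and A :: "('a::{t2_space,second_countable_topology}, real^3) atlas"
    and G :: "'a monoid"
    and g :: "'a metric"
    and J :: "'a endo"
    and e1 e2 e3 :: "'a vfield"
    and D :: "'a connection"
  assumes "\<alpha> + \<delta> \<noteq> 0" and "\<alpha> * \<gamma> + \<beta> * \<delta> = 0"
    and "lie_group A G" and "connected (UNIV :: 'a set)"
    and "lorentzian_metric_3 A g" and "left_invariant_metric A G g"
    and "lie_algebra_basis A G e1 e2 e3"
    and "\<forall>p. pseudo_orthonormal (g p) (e1 p) (e2 p) (e3 p)"
    and "lie_bracket e1 e2 = 0"
    and "lie_bracket e1 e3 = (\<lambda>_. \<alpha>) \<star> e1 + (\<lambda>_. \<beta>) \<star> e2"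
    and "lie_bracket e2 e3 = (\<lambda>_. \<gamma>) \<star> e1 + (\<lambda>_. \<delta>) \<star> e2"
    and "tensor_11 A J" and "left_invariant_endo A G J"
    and "\<forall>X\<in>vector_fields A. endo_apply J (endo_apply J X) = X"
    and "endo_apply J e1 = e1" and "endo_apply J e2 = e2" and "endo_apply J e3 = - e3"
    and "levi_civita_connection A g D"
  shows "admits_left_invariant_ricci_collineations A G g (canonical_connection D J) e1 e2 e3"
proof -
  have frame: "(\<lambda>_. c$1) \<star> e1 + (\<lambda>_. c$2) \<star> e2 + (\<lambda>_. c$3) \<star> e3 \<in> left_invariant_fields A G"
    for c :: "real^3"
    using assms(7) by (simp add: lie_algebra_basis_def)
  have li: "e1 \<in> left_invariant_fields A G" "e2 \<in> left_invariant_fields A G"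
    "e3 \<in> left_invariant_fields A G"
    \<comment> \<open>The standard basis of \<open>real^3\<close> as coefficients singles out each
      frame field.\<close>
    using frame[of "axis 1 1"] frame[of "axis 2 1"] frame[of "axis 3 1"]
    by (simp_all add: axis_def vf_scale_def plus_fun_def)
  interpret canonical_frame A g e1 e2 e3 J D \<alpha> \<beta> \<gamma> \<delta>
    by unfold_locales
      (use assms li in \<open>auto simp: lie_group_def left_invariant_fields_def\<close>)
  have "e1 \<noteq> 0"
  proof
    assume "e1 = 0"
    then have "metric_apply g 0 e1 = (\<lambda>_. 1)" using frame_metric(1) by simp
    then show False using metric_zero[OF frame_vf(1)] by (simp add: fun_eq_iff)
  qed
  \<comment> \<open>e1 serves as the witness; it is nonzero because g(e1, e1) = 1.\<close>
  moreover have "left_invariant_ricci_collineation A G g D0 e1 e2 e3 e1"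
    using li(1) lie_derivative_ricci_zero frame_vf(1)
    by (simp add: left_invariant_ricci_collineation_def)
  ultimately show ?thesis
    unfolding admits_left_invariant_ricci_collineations_def by blast
qed

end
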